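(* Let $G_{\mathcal{R}}$ be a residual graph with reference vertex $0$, and let $G_{\mathcal{F}}$ be a fault graph over $G_{\mathcal{R}}$ (both as defined in the context). Then $G_{\mathcal{F}}$ is detectable if and only if every (weakly) connected component of $G_{\mathcal{F}}$ is a directed tree.
   Context: Residual graph. $G_{\mathcal{R}}$ is a finite directed graph with vertex set $V$ containing a distinguished reference vertex $0$. It is a directed tree rooted at $0$, with edges oriented away from $0$: every vertex $i \in V\setminus\{0\}$ has exactly one incoming edge, from its parent $p(i)$, and vertex $0$ has no incoming edge. The edge $p(i)\to i$ carries a known real quantity $\mathcal{E}_i$ (the residual of sensor $i$). Fault graph. A fault graph $G_{\mathcal{F}}$ over $G_{\mathcal{R}}$ is a directed multigraph with the same vertex set $V$. Its edges form an arbitrary subset of the following possible edges: for each $i\in V\setminus\{0\}$, a sensor fault edge $\mathcal{D}_i$ directed from $i$ to $p(i)$ (opposite to the residual edge $p(i)\to i$), and a process fault edge $\mathcal{L}_i$ directed from $i$ to $0$. If $p(i)=0$, then $\mathcal{D}_i$ and $\mathcal{L}_i$ are two distinct parallel edges. Each edge present in $G_{\mathcal{F}}$ carries an unknown real quantity (the value of the fault). $G_{\mathcal{FR}}$ is the directed multigraph on $V$ whose edges are those of $G_{\mathcal{R}}$ together with those of $G_{\mathcal{F}}$. Incidence matrix. For a directed multigraph $G$ without self-loops, the incidence matrix $\mathbf{I}_G$ has rows indexed by vertices and columns indexed by edges. Its entry $(v,e)$ is $+1$ if $e$ leaves $v$, $-1$ if $e$ enters $v$, and $0$ otherwise. Detectability.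 The nodal equations are $\mathbf{I}_{G_{\mathcal{FR}}}X=0$, where $X$ is the vector of all edge quantities. Separating unknown from known quantities, they read $\mathbf{A}X_{\mathcal{F}}=\mathbf{B}X_{\mathcal{R}}$, where $X_{\mathcal{F}}$ is the real vector of unknown fault values (indexed by the edges of $G_{\mathcal{F}}$), $X_{\mathcal{R}}$ is the real vector of residuals (indexed by the edges of $G_{\mathcal{R}}$), $\mathbf{A}=\mathbf{I}_{G_{\mathcal{F}}}$ and $\mathbf{B}=-\mathbf{I}_{G_{\mathcal{R}}}$. $G_{\mathcal{F}}$ is called detectable if all the unknown faults are solvable from these equations. That is, for every $X_{\mathcal{R}}$ for which the system $\mathbf{A}X_{\mathcal{F}}=\mathbf{B}X_{\mathcal{R}}$ has a solution $X_{\mathcal{F}}$, that solution is unique. Directed tree. A directed tree (polytree) is a directed acyclic graph whose underlying undirected (multi)graph is a tree, i.e. connected without cycles. Two parallel edges count as a cycle, and a single vertex with no edges is a (trivial) directed tree. Connected components of $G_{\mathcal{F}}$ are taken in the underlying undirected multigraph. *)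

theory Defs
  imports Complex_Main "HOL-Library.FuncSet" "Graph_Theory.Graph_Theory"
begin

section \<open>Directed trees and weakly connected components of directed multigraphs\<close>

text \<open>
  The underlying undirected multigraph is represented by the digraph in which every arc
  \<open>e\<close> may be traversed forwards, as \<open>(e, True)\<close>, or backwards, as \<open>(e, False)\<close>.
\<close>
definition both_ways :: "('a, 'b) pre_digraph \<Rightarrow> ('a, 'b \<times> bool) pre_digraph" where
  "both_ways G =
     \<lparr> verts = verts G,
       arcs = arcs G \<times> UNIV,
       tail = (\<lambda>(e, fwd). if fwd then tail G e else head G e),
       head = (\<lambda>(e, fwd). if fwd then head G e else tail G e) \<rparr>"

text \<open>
  Distinctness of the arcs only excludes traversing one arc back and forth; two parallel
  (or antiparallel) arcs do form a cycle of length 2.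
\<close>
definition undirected_cycle :: "('a, 'b) pre_digraph \<Rightarrow> ('b \<times> bool) list \<Rightarrow> bool" where
  "undirected_cycle G p \<longleftrightarrow> pre_digraph.cycle (both_ways G) p \<and> distinct (map fst p)"

text \<open>
  In \<open>Graph_Theory\<close>, \<open>connected\<close> refers to the underlying undirected graph (and requires a
  nonempty vertex set), whereas \<open>forest\<close> excludes directed cycles only, i.e. it says that the
  digraph is acyclic.  Hence the third conjunct.
\<close>
definition directed_tree :: "('a, 'b) pre_digraph \<Rightarrow> bool" where
  "directed_tree G \<longleftrightarrow>
     Digraph_Component.connected G \<and> forest G \<and> \<not> (\<exists>p. undirected_cycle G p)"

definition weak_component :: "('a, 'b) pre_digraph \<Rightarrow> ('a, 'b) pre_digraph \<Rightarrow> bool" where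
  "weak_component G H \<longleftrightarrow> pre_digraph.max_subgraph G Digraph_Component.connected H"

section \<open>Residual graphs and fault graphs\<close>

locale residual_graph = fin_digraph R
  for R :: "('a, 'b) pre_digraph" and r :: 'a +
  assumes root_in_verts: "r \<in> verts R"
    and is_directed_tree: "directed_tree R"
    and reachable_from_root: "v \<in> verts R \<Longrightarrow> r \<rightarrow>\<^sup>*\<^bsub>R\<^esub> v"
    and in_degree_root: "in_degree R r = 0"
    and in_degree_nonroot: "v \<in> verts R \<Longrightarrow> v \<noteq> r \<Longrightarrow> in_degree R v = 1"

definition parent :: "('a, 'b) pre_digraph \<Rightarrow> 'a \<Rightarrow> 'a" where
  "parent R i = tail R (THE e. e \<in> in_arcs R i)"

datatype 'a fault = Sensor 'a | Process 'a

definition possible_faults :: "('a, 'b) pre_digraph \<Rightarrow> 'a \<Rightarrow> 'a fault set" where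
  "possible_faults R r = Sensor ` (verts R - {r}) \<union> Process ` (verts R - {r})"

definition fault_graph ::
  "('a, 'b) pre_digraph \<Rightarrow> 'a \<Rightarrow> 'a fault set \<Rightarrow> ('a, 'a fault) pre_digraph" where
  "fault_graph R r S =
     \<lparr> verts = verts R,
       arcs = S,
       tail = (\<lambda>f. case f of Sensor i \<Rightarrow> i | Process i \<Rightarrow> i),
       head = (\<lambda>f. case f of Sensor i \<Rightarrow> parent R i | Process i \<Rightarrow> r) \<rparr>"

section \<open>Nodal equations and detectability\<close>

text \<open>
  Matrices with rows indexed by vertices and columns by arcs are functions; only the entries
  with row in \<open>verts G\<close> and column in \<open>arcs G\<close> are used.  The digraphs are loop-free.
\<close>
definition incidence :: "('a, 'b) pre_digraph \<Rightarrow> 'a \<Rightarrow> 'b \<Rightarrow> real" where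
  "incidence G v e = (if tail G e = v then 1 else if head G e = v then -1 else 0)"

abbreviation arc_vectors :: "('a, 'b) pre_digraph \<Rightarrow> ('b \<Rightarrow> real) set" where
  "arc_vectors G \<equiv> arcs G \<rightarrow>\<^sub>E UNIV"

definition matrix_vector :: "'b set \<Rightarrow> ('a \<Rightarrow> 'b \<Rightarrow> real) \<Rightarrow> ('b \<Rightarrow> real) \<Rightarrow> 'a \<Rightarrow> real" where
  "matrix_vector C M X v = (\<Sum>e\<in>C. M v e * X e)"

definition residual_fault_graph ::
  "('a, 'b) pre_digraph \<Rightarrow> ('a, 'c) pre_digraph \<Rightarrow> ('a, 'b + 'c) pre_digraph" where
  "residual_fault_graph R F =
     \<lparr> verts = verts R,
       arcs = arcs R <+> arcs F,
       tail = case_sum (tail R) (tail F),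
       head = case_sum (head R) (head F) \<rparr>"

text \<open>The system \<open>A X\<^sub>F = B X\<^sub>R\<close> with \<open>A = I\<^sub>F\<close> and \<open>B = - I\<^sub>R\<close>.\<close>
definition fault_equations ::
  "('a, 'b) pre_digraph \<Rightarrow> ('a, 'c) pre_digraph \<Rightarrow> ('b \<Rightarrow> real) \<Rightarrow> ('c \<Rightarrow> real) \<Rightarrow> bool" where
  "fault_equations R F XR XF \<longleftrightarrow>
     (\<forall>v\<in>verts R. matrix_vector (arcs F) (incidence F) XF v =
                  matrix_vector (arcs R) (\<lambda>v e. - incidence R v e) XR v)"

definition detectable :: "('a, 'b) pre_digraph \<Rightarrow> ('a, 'c) pre_digraph \<Rightarrow> bool" where
  "detectable R F \<longleftrightarrow>
     (\<forall>XR\<in>arc_vectors R.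
        (\<exists>XF\<in>arc_vectors F. fault_equations R F XR XF) \<longrightarrow>
        (\<exists>!XF. XF \<in> arc_vectors F \<and> fault_equations R F XR XF))"

text \<open>The system is the nodal equations of the combined graph.\<close>
lemma fault_equations_iff_nodal_equations:
  assumes "finite (arcs R)" and "finite (arcs F)"
  shows "fault_equations R F XR XF \<longleftrightarrow>
    (let G = residual_fault_graph R F in
     \<forall>v\<in>verts G. matrix_vector (arcs G) (incidence G) (case_sum XR XF) v = 0)"
proof -
  have "incidence (residual_fault_graph R F) v (Inl e) = incidence R v e"
    "incidence (residual_fault_graph R F) v (Inr f) = incidence F v f" for v e f
    by (simp_all add: incidence_def residual_fault_graph_def)
  then have "matrix_vector (arcs (residual_fault_graph R F)) (incidence (residual_fault_graph R F))
      (case_sum XR XF) v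
    = matrix_vector (arcs R) (incidence R) XR v + matrix_vector (arcs F) (incidence F) XF v" for v
    using assms by (simp add: matrix_vector_def residual_fault_graph_def sum.Plus)
  moreover have "matrix_vector (arcs R) (\<lambda>v e. - incidence R v e) XR v
    = - matrix_vector (arcs R) (incidence R) XR v" for v
    by (simp add: matrix_vector_def sum_negf)
  ultimately have "matrix_vector (arcs F) (incidence F) XF v =
      matrix_vector (arcs R) (\<lambda>v e. - incidence R v e) XR v \<longleftrightarrow>
    matrix_vector (arcs (residual_fault_graph R F)) (incidence (residual_fault_graph R F))
      (case_sum XR XF) v = 0" for v
    by (simp only:) linarith
  moreover have "verts (residual_fault_graph R F) = verts R"
    by (simp add: residual_fault_graph_def)
  ultimately show ?thesis
    by (simp add: fault_equations_def Let_def)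
qed

text \<open>In particular, \<open>p(i) \<noteq> i\<close>, so that fault graphs have no self-loops.\<close>
lemma (in residual_graph) fault_graph_fin_loopfree:
  assumes S: "S \<subseteq> possible_faults R r"
  shows "fin_digraph (fault_graph R r S)" and "loopfree_digraph (fault_graph R r S)"
proof -
  have parent: "parent R i \<in> verts R \<and> parent R i \<noteq> i" if "i \<in> verts R" "i \<noteq> r" for i
  proof -
    from in_degree_nonroot[OF that] obtain e where e: "in_arcs R i = {e}"
      by (auto simp: in_degree_def card_1_singleton_iff)
    then have "e \<in> arcs R" and "head R e = i" by (auto simp: in_arcs_def)
    moreover have "tail R e \<noteq> i"
    proof
      assume "tail R e = i"
      with \<open>e \<in> arcs R\<close> \<open>head R e = i\<close> that have "cycle [e]"
        by (auto simp: cycle_def awalk_def intro!: exI[of _ i])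
      with is_directed_tree show False
        by (auto simp: directed_tree_def forest_def)
    qed
    ultimately show ?thesis using e by (simp add: parent_def)
  qed
  have "finite (possible_faults R r)" by (simp add: possible_faults_def)
  then have "finite S" using S by (rule finite_subset[rotated])
  have wf: "tail (fault_graph R r S) e \<in> verts R \<and> head (fault_graph R r S) e \<in> verts R \<and>
      tail (fault_graph R r S) e \<noteq> head (fault_graph R r S) e" if "e \<in> S" for e
    using that S parent root_in_verts
    by (cases e) (force simp: fault_graph_def possible_faults_def)+
  show "fin_digraph (fault_graph R r S)"
    using \<open>finite S\<close> wf by unfold_locales (auto simp: fault_graph_def)
  show "loopfree_digraph (fault_graph R r S)"
    using wf by unfold_locales (auto simp: fault_graph_def)
qed

end

(* A fault graph is detectable iff its incidence matrix has trivial kernel, i.e. iff it carries no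
   nonzero circulation.  A unit flow around an undirected cycle is a nonzero circulation; conversely,
   orienting the arcs of the support of a circulation along its sign gives a digraph in which every
   vertex that can be entered can be left, so it contains a cycle.  Hence detectability means that
   there is no undirected cycle, and a cycle lies within a single weakly connected component. *)
theory Submission
  imports Defs
begin

section \<open>Undirected cycles\<close>

lemma both_ways_simps [simp]:
  "verts (both_ways G) = verts G"
  "arcs (both_ways G) = arcs G \<times> UNIV"
  "tail (both_ways G) (e, b) = (if b then tail G e else head G e)"
  "head (both_ways G) (e, b) = (if b then head G e else tail G e)"
  by (simp_all add: both_ways_def)

lemma (in wf_digraph) wf_digraph_both_ways: "wf_digraph (both_ways G)"
  by unfold_locales auto

lemma (in loopfree_digraph) loopfree_digraph_both_ways: "loopfree_digraph (both_ways G)"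
proof (intro loopfree_digraph.intro loopfree_digraph_axioms.intro wf_digraph_both_ways)
  show "tail (both_ways G) a \<noteq> head (both_ways G) a" if "a \<in> arcs (both_ways G)" for a
    using that no_loops[of "fst a"] by (cases a; cases "snd a") auto
qed

lemma cas_both_ways_forward:
  "pre_digraph.cas (both_ways G) u (map (\<lambda>e. (e, True)) p) v \<longleftrightarrow> pre_digraph.cas G u p v"
  by (induction p arbitrary: u) (simp_all add: pre_digraph.cas.simps)

lemma awalk_verts_both_ways_forward:
  "pre_digraph.awalk_verts (both_ways G) u (map (\<lambda>e. (e, True)) p) = pre_digraph.awalk_verts G u p"
  by (induction p arbitrary: u) (simp_all add: pre_digraph.awalk_verts.simps)

text \<open>The arcs of a directed cycle are pairwise distinct because its vertices are;
  \<open>cycle_conv\<close> makes this explicit, and it is what the condition on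
  \<open>map fst\<close> requires of the lifted list.\<close>

lemma (in wf_digraph) cycle_imp_undirected_cycle:
  assumes "cycle p"
  shows "undirected_cycle G (map (\<lambda>e. (e, True)) p)"
  using assms unfolding cycle_conv
  by (auto simp: undirected_cycle_def pre_digraph.cycle_def pre_digraph.awalk_def
      cas_both_ways_forward awalk_verts_both_ways_forward comp_def)

lemma (in wf_digraph) directed_tree_iff:
  "directed_tree G \<longleftrightarrow> Digraph_Component.connected G \<and> \<not> (\<exists>p. undirected_cycle G p)"
  using cycle_imp_undirected_cycle by (auto simp: directed_tree_def forest_def)

lemma subgraph_both_ways:
  assumes "subgraph H G"
  shows "subgraph (both_ways H) (both_ways G)"
proof -
  have "compatible (both_ways G) (both_ways H)"
    using assms by (auto simp: subgraph_def compatible_def both_ways_def)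
  with assms show ?thesis
    by (auto simp: subgraph_def wf_digraph.wf_digraph_both_ways)
qed

lemma subgraph_undirected_cycle:
  assumes "subgraph H G" "undirected_cycle H p"
  shows "undirected_cycle G p"
proof -
  have "wf_digraph (both_ways G)"
    using assms by (auto simp: subgraph_def wf_digraph.wf_digraph_both_ways)
  then show ?thesis
    using assms wf_digraph.subgraph_cycle[OF _ subgraph_both_ways]
    by (auto simp: undirected_cycle_def)
qed

section \<open>Weakly connected components\<close>

text \<open>Among the connected subgraphs of \<open>G\<close> that contain \<open>K\<close>, one
  with the greatest number of vertices plus arcs is maximal. Such a subgraph exists because
  finiteness of \<open>G\<close> bounds this number.\<close>

lemma (in fin_digraph) connected_subgraph_in_weak_component:
  assumes K: "subgraph K G" "Digraph_Component.connected K"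
  obtains H where "weak_component G H" "subgraph K H"
proof -
  let ?P = "\<lambda>H. subgraph H G \<and> Digraph_Component.connected H \<and> subgraph K H"
  let ?size = "\<lambda>H. card (verts H) + card (arcs H)"
  have "?P K"
    using K wf_digraph.subgraph_refl by (auto simp: subgraph_def)
  moreover have "\<forall>H. ?P H \<longrightarrow> ?size H < Suc (?size G)"
    by (auto simp: less_Suc_eq_le elim!: subgraphE intro!: add_mono card_mono)
  ultimately obtain H where H: "?P H" and max: "\<And>H'. ?P H' \<Longrightarrow> ?size H' \<le> ?size H"
    using ex_has_greatest_nat[of ?P K ?size] by blast
  have "H' = H" if H': "subgraph H H'" "subgraph H' G" "Digraph_Component.connected H'" for H'
  proof -
    have fin: "finite (verts H')" "finite (arcs H')"
      using fin_digraph_subgraph[OF H'(2)] by (auto simp: fin_digraph.finite_verts fin_digraph.finite_arcs)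
    have sub: "verts H \<subseteq> verts H'" "arcs H \<subseteq> arcs H'"
      using H' by auto
    have "?size H' \<le> ?size H"
      using H H' subgraph_trans by (intro max) blast
    moreover have "card (verts H) \<le> card (verts H')" "card (arcs H) \<le> card (arcs H')"
      using sub fin by (auto intro: card_mono)
    ultimately have "card (verts H) = card (verts H')" "card (arcs H) = card (arcs H')"
      by auto
    then have "verts H = verts H'" "arcs H = arcs H'"
      using sub fin by (auto dest: card_subset_eq)
    with H' show ?thesis
      by (auto simp: subgraph_def compatible_def intro: pre_digraph.equality)
  qed
  with H have "weak_component G H"
    by (auto simp: weak_component_def pre_digraph.max_subgraph_def)
  with H that show thesis by blast
qed

text \<open>Any two vertices of the enlarged graph are joined by a route through \<open>a\<close>.
  The set equation leaves the direction of \<open>e\<close> open, and \<open>b\<close> may already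
  belong to \<open>H\<close>.\<close>

lemma connected_add_arc:
  assumes conn: "Digraph_Component.connected H"
    and a: "a \<in> verts H"
    and e: "{tail H e, head H e} = {a, b}"
  shows "Digraph_Component.connected
    (H\<lparr>verts := insert b (verts H), arcs := insert e (arcs H)\<rparr>)" (is "Digraph_Component.connected ?H'")
proof -
  let ?Q = "rtrancl_on (verts ?H') ((arcs_ends ?H')\<^sup>s)"
  have "rtrancl_on (verts H) ((arcs_ends H)\<^sup>s) \<subseteq> ?Q"
    by (intro subrelI, rule rtrancl_on_mono[rotated 2], assumption)
      (auto simp: arcs_ends_conv symcl_def)
  then have old: "(x, y) \<in> ?Q" if "x \<in> verts H" "y \<in> verts H" for x y
    using conn that by (auto simp: connected_conv)
  have "(a, b) \<in> (arcs_ends ?H')\<^sup>s" "(b, a) \<in> (arcs_ends ?H')\<^sup>s"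
    using e by (auto simp: arcs_ends_conv symcl_def doubleton_eq_iff)
  then have ab: "(a, b) \<in> ?Q" "(b, a) \<in> ?Q"
    using a by (auto intro: rtrancl_on_into_rtrancl_on[OF rtrancl_on_refl])
  have via_a: "(x, a) \<in> ?Q" "(a, x) \<in> ?Q" if "x \<in> verts ?H'" for x
    using that ab old a by auto
  then have "(x, y) \<in> ?Q" if "x \<in> verts ?H'" "y \<in> verts ?H'" for x y
    using rtrancl_on_trans[OF via_a(1) via_a(2)] that by simp
  then show ?thesis
    by (auto simp: connected_conv)
qed

text \<open>Adding \<open>e\<close> and its other end to \<open>H\<close> gives a connected subgraph
  of \<open>G\<close>, which by maximality is \<open>H\<close> itself. Hence no arc of
  \<open>G\<close> leads out of a component.\<close>

lemma weak_component_closed: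
  assumes comp: "weak_component G H"
    and e: "e \<in> arcs G" "tail G e \<in> verts H \<or> head G e \<in> verts H"
  shows "e \<in> arcs H" "tail G e \<in> verts H" "head G e \<in> verts H"
proof -
  have sub: "subgraph H G" and conn: "Digraph_Component.connected H"
    and max: "\<And>H'. subgraph H H' \<Longrightarrow> subgraph H' G \<Longrightarrow> Digraph_Component.connected H' \<Longrightarrow> H' = H"
    using comp by (auto simp: weak_component_def pre_digraph.max_subgraph_def)
  have wf: "wf_digraph G" "wf_digraph H" and ends: "tail H = tail G" "head H = head G"
    using sub by (auto simp: subgraph_def compatible_def)
  obtain a b where ab: "a \<in> verts H" "{tail G e, head G e} = {a, b}"
    using e(2) by blast
  let ?H' = "H\<lparr>verts := insert b (verts H), arcs := insert e (arcs H)\<rparr>"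
  have "Digraph_Component.connected ?H'"
    using connected_add_arc[OF conn ab(1)] ab(2) ends by simp
  moreover have "wf_digraph ?H'"
    using wf ab ends by unfold_locales (auto simp: wf_digraph_def doubleton_eq_iff)
  then have "subgraph H ?H'" "subgraph ?H' G"
    using sub wf e(1) ab by (auto simp: subgraph_def compatible_def wf_digraph_def doubleton_eq_iff)
  ultimately have "?H' = H"
    using max by blast
  then have "verts ?H' = verts H" "arcs ?H' = arcs H"
    by (simp_all only:)
  then have "insert b (verts H) = verts H" "insert e (arcs H) = arcs H"
    by simp_all
  then show "e \<in> arcs H" "tail G e \<in> verts H" "head G e \<in> verts H"
    using ab by (auto simp: doubleton_eq_iff)
qed

text \<open>By \<open>weak_component_closed\<close> the first arc and its far end lie in
  \<open>H\<close>, so the rest of the walk starts in \<open>H\<close> again.\<close>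

lemma weak_component_awalk:
  assumes comp: "weak_component G H"
    and "pre_digraph.cas (both_ways G) u p v" "set p \<subseteq> arcs (both_ways G)" "u \<in> verts H"
  shows "set p \<subseteq> arcs (both_ways H)"
  using assms(2-)
proof (induction p arbitrary: u)
  case (Cons a p)
  obtain e b where a: "a = (e, b)" by (cases a)
  then have "e \<in> arcs G" "tail G e \<in> verts H \<or> head G e \<in> verts H"
    using Cons.prems by (auto simp: pre_digraph.cas.simps split: if_splits)
  note * = weak_component_closed[OF comp this]
  then have "set p \<subseteq> arcs (both_ways H)"
    using Cons.prems a by (intro Cons.IH[of "head (both_ways G) a"]) (auto simp: pre_digraph.cas.simps)
  with * a show ?case by auto
qed simp

lemma (in fin_digraph) undirected_cycle_in_weak_component:
  assumes "undirected_cycle G p"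
  obtains H where "weak_component G H" "undirected_cycle H p"
proof -
  obtain u where u: "u \<in> verts G" "set p \<subseteq> arcs (both_ways G)"
    "pre_digraph.cas (both_ways G) u p u"
    "distinct (tl (pre_digraph.awalk_verts (both_ways G) u p))" "p \<noteq> []" "distinct (map fst p)"
    using assms by (auto simp: undirected_cycle_def pre_digraph.cycle_def pre_digraph.awalk_def)
  \<comment> \<open>The component of the cycle is found by extending the subgraph that consists of
    the start vertex \<open>u\<close> alone.\<close>
  let ?K = "\<lparr>verts = {u}, arcs = {}, tail = tail G, head = head G\<rparr>"
  have "subgraph ?K G"
    using u(1) by (auto simp: subgraph_def compatible_def wf_digraph_def)
  moreover have "Digraph_Component.connected ?K"
    by (auto simp: connected_conv)
  ultimately obtain H where H: "weak_component G H" "subgraph ?K H"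
    by (rule connected_subgraph_in_weak_component)
  then have "u \<in> verts H" "compatible (both_ways G) (both_ways H)"
    by (auto simp: weak_component_def pre_digraph.max_subgraph_def dest: subgraph_both_ways)
  moreover have "set p \<subseteq> arcs (both_ways H)"
    using weak_component_awalk[OF H(1)] u \<open>u \<in> verts H\<close> by blast
  ultimately have "undirected_cycle H p"
    using u unfolding undirected_cycle_def pre_digraph.cycle_def pre_digraph.awalk_def
    by (auto simp: compatible_cas compatible_awalk_verts)
  with H that show thesis by blast
qed

text \<open>Components are connected by definition, so only their undirected cycles matter. These
  pass from a component to \<open>G\<close> because it is a subgraph, and from \<open>G\<close> to a
  component because a closed walk stays in the component of its start vertex.\<close>

lemma (in fin_digraph) all_weak_components_directed_tree_iff:
  "(\<forall>H. weak_component G H \<longrightarrow> directed_tree H) \<longleftrightarrow> \<not> (\<exists>p. undirected_cycle G p)"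
proof -
  have comp: "subgraph H G" "Digraph_Component.connected H" "wf_digraph H" if "weak_component G H" for H
    using that by (auto simp: weak_component_def pre_digraph.max_subgraph_def)
  show ?thesis
    using comp wf_digraph.directed_tree_iff undirected_cycle_in_weak_component
      subgraph_undirected_cycle by metis
qed

section \<open>Circulations\<close>

text \<open>These are the kernel vectors of the incidence matrix, read as flows conserved at every
  vertex. Values of \<open>X\<close> off \<open>arcs G\<close> are unconstrained, so a circulation
  counts as nonzero only through its values on \<open>arcs G\<close>.\<close>

definition circulation :: "('a, 'b) pre_digraph \<Rightarrow> ('b \<Rightarrow> real) \<Rightarrow> bool" where
  "circulation G X \<longleftrightarrow> (\<forall>v\<in>verts G. matrix_vector (arcs G) (incidence G) X v = 0)"

text \<open>The sum telescopes: each arc contributes +1 at its tail and -1 at its head. On a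
  self-loop this would fail, since \<open>incidence\<close> is then 1 instead of 0.\<close>

lemma (in loopfree_digraph) sum_incidence_awalk:
  assumes "awalk u p w"
  shows "(\<Sum>e\<leftarrow>p. incidence G v e) = of_bool (u = v) - of_bool (w = v)"
  using assms
proof (induction p arbitrary: u)
  case (Cons e p)
  then have "incidence G v e = of_bool (u = v) - of_bool (head G e = v)"
    using no_loops[of e] by (auto simp: incidence_def awalk_Cons_iff)
  with Cons show ?case by (auto simp: awalk_Cons_iff)
qed (auto simp: awalk_Nil_iff)

text \<open>In the absence of loops, the column of the backward copy of an arc is the negative of
  the column of the forward copy. A flow on \<open>both_ways G\<close> thus becomes a signed flow on
  \<open>G\<close>.\<close>

lemma matrix_vector_both_ways:
  assumes fin: "finite (arcs G)" and loopfree: "\<And>e. e \<in> arcs G \<Longrightarrow> tail G e \<noteq> head G e"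
  shows "matrix_vector (arcs (both_ways G)) (incidence (both_ways G)) Y v =
    matrix_vector (arcs G) (incidence G) (\<lambda>e. Y (e, True) - Y (e, False)) v"
proof -
  have "matrix_vector (arcs (both_ways G)) (incidence (both_ways G)) Y v =
      (\<Sum>e\<in>arcs G. \<Sum>b\<in>UNIV. incidence (both_ways G) v (e, b) * Y (e, b))"
    by (simp add: matrix_vector_def sum.cartesian_product)
  also have "\<dots> = (\<Sum>e\<in>arcs G. incidence G v e * (Y (e, True) - Y (e, False)))"
    using loopfree by (intro sum.cong refl) (auto simp: UNIV_bool incidence_def)
  finally show ?thesis by (simp add: matrix_vector_def)
qed

lemma undirected_cycle_imp_circulation:
  assumes "fin_digraph G" "loopfree_digraph G" and cyc: "undirected_cycle G p"
  obtains X where "circulation G X" "\<exists>e\<in>arcs G. X e \<noteq> 0"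
proof -
  interpret fin_digraph G by fact
  interpret loopfree_digraph G by fact
  interpret B: loopfree_digraph "both_ways G" by (rule loopfree_digraph_both_ways)
  obtain u where u: "B.awalk u p u" and "p \<noteq> []" and dist: "distinct (map fst p)"
    using cyc by (auto simp: undirected_cycle_def B.cycle_def)
  \<comment> \<open>\<open>Y\<close> is the unit flow along the cycle. The derived \<open>X\<close>
    is 1 on arcs traversed forwards, -1 on arcs traversed backwards, and 0 elsewhere.\<close>
  define Y :: "'b \<times> bool \<Rightarrow> real" where "Y a = of_bool (a \<in> set p)" for a
  define X where "X e = Y (e, True) - Y (e, False)" for e
  have sub: "set p \<subseteq> arcs (both_ways G)"
    using u by (simp add: B.awalk_def)
  have "matrix_vector (arcs G) (incidence G) X v = 0" for v
  proof -
    have "matrix_vector (arcs G) (incidence G) X v =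
        matrix_vector (arcs (both_ways G)) (incidence (both_ways G)) Y v"
      unfolding X_def using no_loops by (intro matrix_vector_both_ways[symmetric]) auto
    also have "\<dots> = (\<Sum>a\<in>set p. incidence (both_ways G) v a)"
      unfolding matrix_vector_def Y_def
      by (rule sum.mono_neutral_cong_right) (use sub in auto)
    also have "\<dots> = (\<Sum>a\<leftarrow>p. incidence (both_ways G) v a)"
      using dist by (simp add: distinct_map sum_list_distinct_conv_sum_set)
    also have "\<dots> = 0"
      using B.sum_incidence_awalk[OF u] by simp
    finally show ?thesis .
  qed
  then have "circulation G X" by (simp add: circulation_def)
  moreover obtain e b where eb: "(e, b) \<in> set p"
    using \<open>p \<noteq> []\<close> by (metis list.set_sel(1) surj_pair)
  \<comment> \<open>Distinctness of the underlying arcs keeps the two directions of \<open>e\<close>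
    from cancelling in \<open>X\<close>.\<close>
  then have "(e, \<not> b) \<notin> set p"
    using dist inj_onD[of fst "set p" "(e, b)" "(e, \<not> b)"] by (auto simp: distinct_map)
  then have "X e \<noteq> 0"
    using eb by (cases b) (auto simp: X_def Y_def)
  moreover have "e \<in> arcs G"
    using eb sub by auto
  ultimately show thesis using that by blast
qed

text \<open>Without a cycle, the converse of the arc relation is well-founded by finiteness, so
  there is a minimal vertex among the heads of arcs. By \<open>step\<close> an arc leaves that
  vertex, and its head is a smaller one.\<close>

lemma (in fin_digraph) cycle_if_no_sink:
  assumes "arcs G \<noteq> {}"
    and step: "\<And>e. e \<in> arcs G \<Longrightarrow> \<exists>e'\<in>arcs G. tail G e' = head G e"
  shows "\<exists>p. cycle p"
proof (rule ccontr)
  assume no_cycle: "\<nexists>p. cycle p"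
  have "acyclic ((arcs_ends G)\<inverse>)"
  proof (unfold acyclic_converse, rule acyclicI, intro allI notI)
    fix x assume "x \<rightarrow>\<^sup>+ x"
    then obtain p where "awalk x p x" "p \<noteq> []"
      by (auto simp: reachable1_awalk)
    then show False
      using no_cycle closed_w_imp_cycle by (auto simp: closed_w_def)
  qed
  moreover have "finite ((arcs_ends G)\<inverse>)"
    by (simp add: arcs_ends_conv)
  ultimately have "wf ((arcs_ends G)\<inverse>)"
    by (rule finite_acyclic_wf[rotated])
  then obtain z where "z \<in> head G ` arcs G"
    and min: "\<And>y. (y, z) \<in> (arcs_ends G)\<inverse> \<Longrightarrow> y \<notin> head G ` arcs G"
    using \<open>arcs G \<noteq> {}\<close> by (metis wfE_min' image_is_empty)
  then obtain e' where "e' \<in> arcs G" "tail G e' = z"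
    using step by (metis imageE)
  moreover from this have "(head G e', z) \<in> (arcs_ends G)\<inverse>"
    by (force simp: arcs_ends_conv)
  ultimately show False
    using min by blast
qed

lemma circulation_imp_undirected_cycle:
  assumes "fin_digraph G" "loopfree_digraph G"
    and circ: "circulation G X" and nz: "\<exists>e\<in>arcs G. X e \<noteq> 0"
  obtains p where "undirected_cycle G p"
proof -
  interpret fin_digraph G by fact
  interpret loopfree_digraph G by fact
  \<comment> \<open>\<open>D\<close> keeps each arc with nonzero value in the direction of its flow.
    At most one of the two copies of an arc survives, so a cycle of \<open>D\<close> has distinct
    underlying arcs.\<close>
  define D where "D = (both_ways G)
    \<lparr>arcs := {(e, b). e \<in> arcs G \<and> (if b then 0 < X e else X e < 0)}\<rparr>"
  have D [simp]: "verts D = verts G" "tail D = tail (both_ways G)" "head D = head (both_ways G)"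
    "arcs D = {(e, b). e \<in> arcs G \<and> (if b then 0 < X e else X e < 0)}"
    by (simp_all add: D_def)
  have "finite (arcs D)"
    by (rule finite_subset[of _ "arcs G \<times> UNIV"]) auto
  then interpret D: fin_digraph D
    by unfold_locales auto
  have sub: "subgraph D (both_ways G)"
    using D.wf_digraph wf_digraph_both_ways by (auto simp: subgraph_def compatible_def)
  have "\<exists>a'\<in>arcs D. tail D a' = head D a" if "a \<in> arcs D" for a
  proof (rule ccontr)
    assume no_exit: "\<not> ?thesis"
    define v where "v = head D a"
    obtain e b where a: "a = (e, b)" by (cases a)
    \<comment> \<open>A positive term in the conservation law at \<open>v\<close> would come from an
      arc of \<open>D\<close> leaving \<open>v\<close>. With no such arc all terms are nonpositive,
      while \<open>a\<close>, which enters \<open>v\<close>, makes one of them negative, so the sum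
      cannot be 0.\<close>
    have nonpos: "incidence G v f * X f \<le> 0" if f: "f \<in> arcs G" for f
    proof (rule ccontr)
      assume "\<not> ?thesis"
      then obtain b' where "(f, b') \<in> arcs D \<and> tail D (f, b') = v"
        using f that[of True] that[of False] by (auto simp: incidence_def split: if_splits)
      then show False
        using no_exit v_def by blast
    qed
    have e: "e \<in> arcs G" and neg: "incidence G v e * X e < 0"
      using that a no_loops[of e] by (auto simp: v_def incidence_def split: if_splits)
    have "(\<Sum>f\<in>arcs G. incidence G v f * X f) < (\<Sum>f\<in>arcs G. 0)"
      using nonpos e neg by (intro sum_strict_mono_ex1) auto
    moreover have "v \<in> verts G"
      using that D.head_in_verts[of a] by (simp add: v_def)
    ultimately show False
      using circ by (auto simp: circulation_def matrix_vector_def)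
  qed
  moreover have "arcs D \<noteq> {}"
  proof -
    from nz obtain e where "e \<in> arcs G" "X e \<noteq> 0" by blast
    then have "(e, 0 < X e) \<in> arcs D" by auto
    then show ?thesis by blast
  qed
  ultimately obtain p where p: "D.cycle p"
    using D.cycle_if_no_sink by blast
  then have "distinct p" "set p \<subseteq> arcs D"
    by (auto simp: D.cycle_conv D.awalk_def)
  moreover have "inj_on fst (arcs D)"
    by (auto simp: inj_on_def split: if_splits)
  ultimately have "distinct (map fst p)"
    by (auto simp: distinct_map intro: inj_on_subset)
  moreover have "pre_digraph.cycle (both_ways G) p"
    using wf_digraph.subgraph_cycle[OF wf_digraph_both_ways sub p] .
  ultimately show thesis
    using that by (auto simp: undirected_cycle_def)
qed

section \<open>Detectability\<close>

text \<open>For a linear system, uniqueness of solutions means a trivial kernel: the zero residual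
  is solvable by the zero fault vector, and two solutions for the same residual differ by a
  circulation.\<close>

lemma detectable_iff_circulation:
  assumes verts: "verts F = verts R"
  shows "detectable R F \<longleftrightarrow> (\<forall>X. circulation F X \<longrightarrow> (\<forall>e\<in>arcs F. X e = 0))"
proof
  assume det: "detectable R F"
  let ?zR = "\<lambda>e\<in>arcs R. 0 :: real"
  show "\<forall>X. circulation F X \<longrightarrow> (\<forall>e\<in>arcs F. X e = 0)"
  proof (intro allI impI ballI)
    fix X e assume X: "circulation F X" and e: "e \<in> arcs F"
    \<comment> \<open>A circulation is arbitrary off \<open>arcs F\<close>, whereas the members of
      \<open>arc_vectors F\<close> are extensional, so it must be restricted before it can be
      compared with other solutions.\<close>
    have eq: "fault_equations R F ?zR (restrict Y (arcs F))" if "circulation F Y" for Y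
      using that verts by (auto simp: fault_equations_def circulation_def matrix_vector_def)
    have "fault_equations R F ?zR (restrict X (arcs F))"
      "fault_equations R F ?zR (\<lambda>e\<in>arcs F. 0)"
      using X by (auto intro!: eq simp: circulation_def matrix_vector_def)
    then have "restrict X (arcs F) = (\<lambda>e\<in>arcs F. 0)"
      using det unfolding detectable_def by (metis restrict_PiE UNIV_I restrict_PiE_iff)
    with e show "X e = 0" by (metis restrict_apply')
  qed
next
  assume ker: "\<forall>X. circulation F X \<longrightarrow> (\<forall>e\<in>arcs F. X e = 0)"
  have "X = Y" if X: "X \<in> arc_vectors F" "fault_equations R F XR X"
    and Y: "Y \<in> arc_vectors F" "fault_equations R F XR Y" for XR X Y
  proof (rule PiE_ext[OF X(1) Y(1)])
    have "circulation F (\<lambda>e. X e - Y e)"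
      using X(2) Y(2) verts
      by (auto simp: circulation_def fault_equations_def matrix_vector_def right_diff_distrib sum_subtractf)
    with ker show "X e = Y e" if "e \<in> arcs F" for e
      using that by fastforce
  qed
  then show "detectable R F"
    unfolding detectable_def by blast
qed

theorem theorem1:
  fixes R :: "('a, 'b) pre_digraph" and r :: 'a and S :: "'a fault set"
  assumes "residual_graph R r"
    and "S \<subseteq> possible_faults R r"
  shows "detectable R (fault_graph R r S) \<longleftrightarrow>
    (\<forall>H. weak_component (fault_graph R r S) H \<longrightarrow> directed_tree H)"
proof -
  let ?F = "fault_graph R r S"
  have F: "fin_digraph ?F" "loopfree_digraph ?F"
    using residual_graph.fault_graph_fin_loopfree[OF assms] by auto
  have "detectable R ?F \<longleftrightarrow> (\<forall>X. circulation ?F X \<longrightarrow> (\<forall>e\<in>arcs ?F. X e = 0))"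
    by (rule detectable_iff_circulation) (simp add: fault_graph_def)
  also have "\<dots> \<longleftrightarrow> \<not> (\<exists>p. undirected_cycle ?F p)"
    using undirected_cycle_imp_circulation[OF F] circulation_imp_undirected_cycle[OF F] by metis
  also have "\<dots> \<longleftrightarrow> (\<forall>H. weak_component ?F H \<longrightarrow> directed_tree H)"
    using fin_digraph.all_weak_components_directed_tree_iff[OF F(1)] by simp
  finally show ?thesis .
qed

end
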